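(* Assume that $\mathcal F:\mathbb R^n\to\mathbb R^k$ is such that $\tilde{\mathcal J}(\boldsymbol u;\boldsymbol u_0,\mathbf d,\boldsymbol\xi)$ is a convex, twice continuously differentiable function of $\boldsymbol u$ for almost every $\boldsymbol\xi$, and is measurable (with respect to the product of the $\sigma$-algebras of the deterministic variables $(\boldsymbol u,\boldsymbol u_0,\mathbf d)$ and of the random variable $\boldsymbol\xi$). Then: (i) Minimizing $\mathscr J$ is equivalent to minimizing $\mathcal J$, in the sense that $\arg\min_{\boldsymbol u}\mathcal J=\arg\min_{\boldsymbol u}\mathscr J$. (ii) $\hat{\boldsymbol u}^{\mathrm{MAP}}_N\to\boldsymbol u^{\mathrm{MAP}}$ almost surely as $N\to\infty$.
   Context: Fix $\mathbf d\in\mathbb R^k$, $\boldsymbol u_0\in\mathbb R^n$, and (symmetric positive definite) covariance matrices $\boldsymbol\Sigma\in\mathbb R^{k\times k}$ (noise) and $\boldsymbol\Gamma\in\mathbb R^{n\times n}$ (prior). For a symmetric positive (semi)definite matrix $W$ write $\|x\|_W^2:=x^TWx$. Let $\mathcal F:\mathbb R^n\to\mathbb R^k$ be the (possibly nonlinear) parameter-to-observable map, and define $$\mathcal J(\boldsymbol u;\boldsymbol u_0,\mathbf d):=\tfrac12\|\mathbf d-\mathcal F(\boldsymbol u)\|^2_{\boldsymbol\Sigma^{-1}}+\tfrac12\|\boldsymbol u-\boldsymbol u_0\|^2_{\boldsymbol\Gamma^{-1}}.$$ Let $\boldsymbol\sigma,\boldsymbol\varepsilon$ (in $\mathbb R^k$)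 and $\boldsymbol\delta,\boldsymbol\lambda$ (in $\mathbb R^n$) be independent random vectors with bounded second moments such that $$\mathbb E[\boldsymbol\sigma]=0,\quad \mathbb E[\boldsymbol\varepsilon\boldsymbol\varepsilon^T]=\boldsymbol\Sigma^{-1},\quad \mathbb E[\boldsymbol\delta]=0,\quad \mathbb E[\boldsymbol\lambda\boldsymbol\lambda^T]=\boldsymbol\Gamma^{-1}.$$ Let $\boldsymbol\xi=[\boldsymbol\sigma,\boldsymbol\varepsilon,\boldsymbol\delta,\boldsymbol\lambda]^T$, with joint law $\pi$ (the product of the four laws), and define $$\tilde{\mathcal J}(\boldsymbol u;\boldsymbol u_0,\mathbf d,\boldsymbol\xi):=\tfrac12\big\|\boldsymbol\varepsilon^T(\mathbf d+\boldsymbol\sigma-\mathcal F(\boldsymbol u))\big\|_2^2+\tfrac12\big\|\boldsymbol\lambda^T(\boldsymbol u-\boldsymbol u_0-\boldsymbol\delta)\big\|_2^2,$$ $$\mathscr J(\boldsymbol u;\boldsymbol u_0,\mathbf d):=\mathbb E_\pi[\tilde{\mathcal J}(\boldsymbol u;\boldsymbol u_0,\mathbf d,\boldsymbol\xi)],\qquad \mathscr J_N(\boldsymbol u):=\frac1N\sum_{j=1}^N\tilde{\mathcal J}(\boldsymbol u;\boldsymbol u_0,\mathbf d,\boldsymbol\xi^j),$$ where $\boldsymbol\xi^1,\boldsymbol\xi^2,\dots$ are i.i.d. samples from $\pi$. Standing assumption: $\mathcal J$ and $\mathscr J_N$ have a minimum. Set $\boldsymbol u^{\mathrm{MAP}}:=\arg\min_{\boldsymbol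 u}\mathcal J$ (the unique minimizer) and $\hat{\boldsymbol u}^{\mathrm{MAP}}_N:=\arg\min_{\boldsymbol u}\mathscr J_N$ (a minimizer). *)

theory Defs
  imports "HOL-Probability.Probability"
begin

definition sym_pos_def :: "real ^ 'm ^ 'm \<Rightarrow> bool" where
  "sym_pos_def W \<longleftrightarrow> transpose W = W \<and> (\<forall>x. x \<noteq> 0 \<longrightarrow> x \<bullet> (W *v x) > 0)"

definition weighted_norm_sq :: "real ^ 'm ^ 'm \<Rightarrow> real ^ 'm \<Rightarrow> real" where
  "weighted_norm_sq W x = x \<bullet> (W *v x)"

definition outer :: "real ^ 'm \<Rightarrow> real ^ 'p \<Rightarrow> real ^ 'p ^ 'm" where
  "outer x y = (\<chi> i j. x $ i * y $ j)"

definition argmin_set :: "('a \<Rightarrow> real) \<Rightarrow> 'a set" where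
  "argmin_set f = {u. is_arg_min f (\<lambda>_. True) u}"

definition twice_cont_differentiable :: "('a::real_normed_vector \<Rightarrow> real) \<Rightarrow> bool" where
  "twice_cont_differentiable f \<longleftrightarrow>
    (\<exists>(f' :: 'a \<Rightarrow> 'a \<Rightarrow>\<^sub>L real) (f'' :: 'a \<Rightarrow> 'a \<Rightarrow>\<^sub>L 'a \<Rightarrow>\<^sub>L real).
      (\<forall>u. (f has_derivative blinfun_apply (f' u)) (at u)) \<and>
      (\<forall>u. (f' has_derivative blinfun_apply (f'' u)) (at u)) \<and>
      continuous_on UNIV f'')"

text \<open>
  The library's notion of independent random variables requires a common value type.
  Here the four vectors live in two different spaces, so independence is stated
  for the sigma-algebras they generate.
\<close>

definition indep_vectors4 ::
  "'a measure \<Rightarrow> ('a \<Rightarrow> real ^ 'k) \<Rightarrow> ('a \<Rightarrow> real ^ 'k) \<Rightarrow> ('a \<Rightarrow> real ^ 'n) \<Rightarrow> ('a \<Rightarrow> real ^ 'n) \<Rightarrow> bool" where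
  "indep_vectors4 P X1 X2 X3 X4 \<longleftrightarrow>
    prob_space.indep_sets P
      (\<lambda>i::nat. [sets (vimage_algebra (space P) X1 borel), sets (vimage_algebra (space P) X2 borel),
                 sets (vimage_algebra (space P) X3 borel), sets (vimage_algebra (space P) X4 borel)] ! i)
      {..<4}"

definition map_objective ::
  "(real ^ 'n \<Rightarrow> real ^ 'k) \<Rightarrow> real ^ 'k ^ 'k \<Rightarrow> real ^ 'n ^ 'n \<Rightarrow> real ^ 'n \<Rightarrow> real ^ 'k \<Rightarrow> real ^ 'n \<Rightarrow> real" where
  "map_objective F S G u0 d u =
    1/2 * weighted_norm_sq (matrix_inv S) (d - F u) + 1/2 * weighted_norm_sq (matrix_inv G) (u - u0)"

text \<open>A sample is a quadruple \<open>(\<sigma>, \<epsilon>, \<delta>, lam)\<close>.\<close>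

type_synonym ('k, 'n) sample = "(real ^ 'k) \<times> (real ^ 'k) \<times> (real ^ 'n) \<times> (real ^ 'n)"

definition rand_objective ::
  "(real ^ 'n \<Rightarrow> real ^ 'k) \<Rightarrow> real ^ 'n \<Rightarrow> real ^ 'k \<Rightarrow> ('k, 'n) sample \<Rightarrow> real ^ 'n \<Rightarrow> real" where
  "rand_objective F u0 d \<xi> u =
    (case \<xi> of (\<sigma>, \<epsilon>, \<delta>, lam) \<Rightarrow>
      1/2 * (norm (\<epsilon> \<bullet> (d + \<sigma> - F u)))\<^sup>2 + 1/2 * (norm (lam \<bullet> (u - u0 - \<delta>)))\<^sup>2)"

definition expected_objective ::
  "('k, 'n) sample measure \<Rightarrow> (real ^ 'n \<Rightarrow> real ^ 'k) \<Rightarrow> real ^ 'n \<Rightarrow> real ^ 'k \<Rightarrow> real ^ 'n \<Rightarrow> real" where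
  "expected_objective \<pi> F u0 d u = (\<integral>\<xi>. rand_objective F u0 d \<xi> u \<partial>\<pi>)"

definition empirical_objective ::
  "nat \<Rightarrow> (nat \<Rightarrow> ('k, 'n) sample) \<Rightarrow> (real ^ 'n \<Rightarrow> real ^ 'k) \<Rightarrow> real ^ 'n \<Rightarrow> real ^ 'k \<Rightarrow> real ^ 'n \<Rightarrow> real" where
  "empirical_objective N \<xi> F u0 d u = 1 / real N * (\<Sum>j=1..N. rand_objective F u0 d (\<xi> j) u)"

end

theory Submission imports Defs begin

text \<open>
  Independence and the centring of \<open>\<sigma>\<close> and \<open>\<delta>\<close> kill the cross terms in the expectation of the
  randomised objective, so it differs from the original objective by a constant; this gives the
  equality of the two sets of minimisers. For the convergence, the strong law of large numbers makes
  the sample averages converge almost surely on a countable dense set of points. Convexity turns this into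
  convergence of minimisers: a sample minimiser staying away from the limit minimiser \<open>u\<close> can be
  pulled along the segment to \<open>u\<close> onto a fixed small sphere without raising the objective above its value
  at \<open>u\<close>, and a cluster point of these points would be a second minimiser of the limit.
  Since the objectives are nonnegative, the strong law follows by Etemadi's argument, with the
  variables truncated at level \<open>a ^ n\<close> along the subsequence \<open>\<lfloor>a ^ n\<rfloor>\<close>.
\<close>

section \<open>The strong law of large numbers for nonnegative variables\<close>

text \<open>A geometric sum is comparable to its largest term, and only powers below
  \<open>x\<close> are summed. Integrated over \<open>x = X 0 \<omega>\<close>, this turns a finite
  first moment into summability of \<open>a ^ n\<close> times the probability of
  \<open>X 0 > a ^ n\<close>.\<close>

lemma sum_geometric_below_le:
  fixes a x :: real
  assumes a: "1 < a" and x: "0 \<le> x"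
  shows "(\<Sum>i<n. a ^ i * indicator {a ^ i<..} x) \<le> a * x / (a - 1)"
proof -
  \<comment> \<open>Two bounds are carried: \<open>a ^ n\<close> drives the induction while
    \<open>a ^ n < x\<close>, because \<open>a ^ n + (a - 1) * a ^ n = a ^ Suc n\<close>, and
    \<open>a * x\<close> is what remains once no further terms are added.\<close>
  have "(a - 1) * (\<Sum>i<n. a ^ i * indicator {a ^ i<..} x) \<le> min (a * x) (a ^ n)"
  proof (induction n)
    case 0
    then show ?case using a x by simp
  next
    case (Suc n)
    show ?case
    proof (cases "a ^ n < x")
      case True
      then have "a * a ^ n \<le> a * x" using a by simp
      then show ?thesis using Suc True a by (simp add: algebra_simps)
    next
      case False
      have "a ^ n \<le> a * a ^ n" using a by simp
      then show ?thesis using Suc False a by (simp add: algebra_simps)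
    qed
  qed
  then have "(a - 1) * (\<Sum>i<n. a ^ i * indicator {a ^ i<..} x) \<le> a * x" by simp
  then show ?thesis using a by (simp add: pos_le_divide_eq mult.commute)
qed

text \<open>The nonzero terms start at the first power not below \<open>x\<close>, where
  \<open>x\<^sup>2 / a ^ i\<close> is at most \<open>x\<close>, and then decrease with ratio
  \<open>1 / a\<close>. Integrated, this controls second moments of truncated variables by the first
  moment.\<close>

lemma sum_geometric_above_le:
  fixes a x :: real
  assumes a: "1 < a" and x: "0 \<le> x"
  shows "(\<Sum>i<n. (x * indicator {..a ^ i} x)\<^sup>2 / a ^ i) \<le> a * x / (a - 1)"
proof -
  \<comment> \<open>The subtracted \<open>a * x\<^sup>2 / a ^ n\<close> is \<open>a - 1\<close>
    times the part of the geometric series still to come; \<open>max 0\<close> covers the stages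
    with \<open>a ^ n < x\<close>, where every term so far is zero.\<close>
  have "(a - 1) * (\<Sum>i<n. (x * indicator {..a ^ i} x)\<^sup>2 / a ^ i) \<le> max 0 (a * x - a * x\<^sup>2 / a ^ n)"
  proof (induction n)
    case 0
    then show ?case by simp
  next
    case (Suc n)
    have pos: "0 < a ^ n" using a by simp
    have step: "a * x\<^sup>2 / a ^ Suc n = x\<^sup>2 / a ^ n" using a by simp
    have mono: "x\<^sup>2 / a ^ n \<le> a * x\<^sup>2 / a ^ n"
      using a pos by (simp add: divide_right_mono mult_le_cancel_right1)
    show ?case
    proof (cases "x \<le> a ^ n")
      case True
      have "x\<^sup>2 / a ^ n \<le> x" using True x pos
        by (simp add: divide_le_eq power2_eq_square mult_left_mono)
      then have nn: "0 \<le> a * x - a * x\<^sup>2 / a ^ n"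
        using a mult_left_mono[of "x\<^sup>2 / a ^ n" x a] by simp
      have "(a - 1) * (\<Sum>i<Suc n. (x * indicator {..a ^ i} x)\<^sup>2 / a ^ i)
          \<le> (a * x - a * x\<^sup>2 / a ^ n) + (a - 1) * (x\<^sup>2 / a ^ n)"
        using Suc nn True by (simp add: distrib_left)
      also have "\<dots> = a * x - x\<^sup>2 / a ^ n"
        by (simp add: algebra_simps diff_divide_distrib)
      finally show ?thesis unfolding step by simp
    next
      case False
      then show ?thesis using Suc mono unfolding step by simp
    qed
  qed
  also have "\<dots> \<le> a * x" using a x by simp
  finally show ?thesis using a by (simp add: pos_le_divide_eq mult.commute)
qed

lemma exists_geometric_bracket:
  fixes a y :: real
  assumes "1 < a" "1 \<le> y"
  obtains n :: nat where "a ^ n \<le> y" "y < a ^ Suc n"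
proof -
  let ?m = "LEAST m. y < a ^ m"
  obtain k where "y < a ^ k" using real_arch_pow[OF assms(1)] by blast
  then have less: "y < a ^ ?m" by (rule LeastI)
  with assms obtain n where n: "?m = Suc n" by (cases ?m) auto
  have "\<not> y < a ^ n" using not_less_Least[of n "\<lambda>m. y < a ^ m"] n by simp
  with that[of n] less n show thesis by simp
qed

text \<open>For \<open>a ^ n \<le> N < a ^ Suc n\<close>, monotonicity traps \<open>s N / N\<close>
  between neighbouring values of the subsequence up to a factor \<open>a\<close>, and letting
  \<open>a\<close> tend to 1 removes the factor. The ratios form a countable family, so that almost
  sure limits can be had for all of them together.\<close>

lemma lim_average_of_geometric_subseq:
  fixes s :: "nat \<Rightarrow> real"
  assumes mono: "mono s" and nonneg: "\<And>n. 0 \<le> s n"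
    and lim: "\<And>k. (\<lambda>n. s (nat \<lfloor>(1 + 1 / real (Suc k)) ^ n\<rfloor>) / (1 + 1 / real (Suc k)) ^ n) \<longlonglongrightarrow> l"
  shows "(\<lambda>n. s n / real n) \<longlonglongrightarrow> l"
proof -
  define a where "a k = 1 + 1 / real (Suc k)" for k
  have a1: "1 < a k" for k by (simp add: a_def)
  have inv: "(\<lambda>k. 1 / real (Suc k)) \<longlonglongrightarrow> 0"
    using LIMSEQ_inverse_real_of_nat by (simp add: inverse_eq_divide)
  have a_lim: "a \<longlonglongrightarrow> 1"
    unfolding a_def using tendsto_add[OF tendsto_const inv, of 1] by simp
  have ev: "eventually (\<lambda>n. (l - 1 / real (Suc k)) / a k \<le> s n / real n \<and>
      s n / real n \<le> a k * (l + 1 / real (Suc k))) sequentially" for k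
  proof -
    let ?t = "\<lambda>n. s (nat \<lfloor>a k ^ n\<rfloor>) / a k ^ n"
    let ?e = "1 / real (Suc k)"
    have "?t \<longlonglongrightarrow> l" using lim[of k] by (simp add: a_def)
    then have "eventually (\<lambda>n. dist (?t n) l < ?e) sequentially"
      by (rule tendstoD) simp
    then obtain n0 where n0: "\<And>n. n \<ge> n0 \<Longrightarrow> dist (?t n) l < ?e"
      unfolding eventually_sequentially by blast
    show ?thesis
      unfolding eventually_sequentially
    \<comment> \<open>From this index on the bracketing exponent \<open>n\<close> is at least
      \<open>n0\<close>; the added 1 keeps \<open>N\<close> positive.\<close>
    proof (intro exI[of _ "nat \<lceil>a k ^ n0\<rceil> + 1"] allI impI)
      fix N assume N: "nat \<lceil>a k ^ n0\<rceil> + 1 \<le> N"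
      then have N1: "1 \<le> real N" and Nn0: "a k ^ n0 \<le> real N" by linarith+
      obtain n where n: "a k ^ n \<le> real N" "real N < a k ^ Suc n"
        using exists_geometric_bracket[OF a1 N1] .
      have "a k ^ n0 < a k ^ Suc n" using Nn0 n by linarith
      then have "n0 < Suc n" using a1[of k] power_less_imp_less_exp by blast
      then have t: "l - ?e \<le> ?t n" "?t (Suc n) \<le> l + ?e"
        using n0[of n] n0[of "Suc n"] unfolding dist_real_def by linarith+
      have pos: "0 < a k ^ n" "0 < a k" using a1[of k] by auto
      have lo: "nat \<lfloor>a k ^ n\<rfloor> \<le> N" using n(1) by linarith
      have hi: "N \<le> nat \<lfloor>a k ^ Suc n\<rfloor>" using n(2) by linarith
      have "(l - ?e) / a k \<le> ?t n / a k" using t(1) pos by (intro divide_right_mono) auto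
      also have "\<dots> = s (nat \<lfloor>a k ^ n\<rfloor>) / a k ^ Suc n" by (simp add: mult.commute)
      also have "\<dots> \<le> s N / real N"
        using n(2) N1 nonneg monoD[OF mono lo] by (intro frac_le) auto
      finally have 1: "(l - ?e) / a k \<le> s N / real N" .
      have "s N / real N \<le> s (nat \<lfloor>a k ^ Suc n\<rfloor>) / a k ^ n"
        using n(1) N1 nonneg monoD[OF mono hi] pos by (intro frac_le) auto
      also have "\<dots> = a k * ?t (Suc n)" using pos by simp
      also have "\<dots> \<le> a k * (l + ?e)" using t(2) pos by (intro mult_left_mono) auto
      finally show "(l - ?e) / a k \<le> s N / real N \<and> s N / real N \<le> a k * (l + ?e)"
        using 1 by blast
    qed
  qed
  have lo: "(\<lambda>k. (l - 1 / real (Suc k)) / a k) \<longlonglongrightarrow> l"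
    using tendsto_divide[OF tendsto_diff[OF tendsto_const inv, of l] a_lim] by simp
  have hi: "(\<lambda>k. a k * (l + 1 / real (Suc k))) \<longlonglongrightarrow> l"
    using tendsto_mult[OF a_lim tendsto_add[OF tendsto_const inv, of l]] by simp
  show ?thesis
  proof (rule order_tendstoI)
    fix c assume "c < l"
    then have "eventually (\<lambda>k. c < (l - 1 / real (Suc k)) / a k) sequentially"
      using lo by (simp add: order_tendstoD)
    then obtain k where "c < (l - 1 / real (Suc k)) / a k"
      using eventually_happens'[OF sequentially_bot] by blast
    with ev[of k] show "eventually (\<lambda>n. c < s n / real n) sequentially"
      by (auto elim!: eventually_mono)
  next
    fix c assume "l < c"
    then have "eventually (\<lambda>k. a k * (l + 1 / real (Suc k)) < c) sequentially"
      using hi by (simp add: order_tendstoD)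
    then obtain k where "a k * (l + 1 / real (Suc k)) < c"
      using eventually_happens'[OF sequentially_bot] by blast
    with ev[of k] show "eventually (\<lambda>n. s n / real n < c) sequentially"
      by (auto elim!: eventually_mono)
  qed
qed

section \<open>Second-moment and Borel-Cantelli estimates for truncated sums\<close>

context prob_space
begin

text \<open>The square of the sum expands into products of only two variables, so pairwise
  independence is what enters: off-diagonal products factor, and the diagonal ones contribute the
  variances.\<close>

lemma variance_sum_indep:
  fixes Y :: "'i \<Rightarrow> 'a \<Rightarrow> real"
  assumes fin: "finite I"
    and indep: "\<And>i j. i \<in> I \<Longrightarrow> j \<in> I \<Longrightarrow> i \<noteq> j \<Longrightarrow> indep_var borel (Y i) borel (Y j)"
    and int: "\<And>i. i \<in> I \<Longrightarrow> integrable M (Y i)"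
    and sq: "\<And>i. i \<in> I \<Longrightarrow> integrable M (\<lambda>\<omega>. (Y i \<omega>)\<^sup>2)"
  shows "integrable M (\<lambda>\<omega>. (\<Sum>i\<in>I. Y i \<omega>)\<^sup>2)"
    and "variance (\<lambda>\<omega>. \<Sum>i\<in>I. Y i \<omega>) = (\<Sum>i\<in>I. variance (Y i))"
proof -
  have prod: "integrable M (\<lambda>\<omega>. Y i \<omega> * Y j \<omega>) \<and>
      expectation (\<lambda>\<omega>. Y i \<omega> * Y j \<omega>) =
        expectation (Y i) * expectation (Y j) + (if i = j then variance (Y i) else 0)"
    if "i \<in> I" "j \<in> I" for i j
  proof (cases "i = j")
    case True
    then show ?thesis
      using that sq[of i] variance_eq[OF int[OF that(1)] sq[OF that(1)]]
      by (simp add: power2_eq_square)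
  next
    case False
    then show ?thesis
      using indep_var_integrable[OF indep int int] indep_var_lebesgue_integral[OF indep int int] that
      by simp
  qed
  have sq_sum: "(\<Sum>i\<in>I. Y i \<omega>)\<^sup>2 = (\<Sum>i\<in>I. \<Sum>j\<in>I. Y i \<omega> * Y j \<omega>)" for \<omega>
    by (simp add: power2_eq_square sum_product)
  show int_sq: "integrable M (\<lambda>\<omega>. (\<Sum>i\<in>I. Y i \<omega>)\<^sup>2)"
    unfolding sq_sum using prod by (intro Bochner_Integration.integrable_sum) auto
  have "expectation (\<lambda>\<omega>. (\<Sum>i\<in>I. Y i \<omega>)\<^sup>2) =
      (\<Sum>i\<in>I. \<Sum>j\<in>I. expectation (Y i) * expectation (Y j) + (if i = j then variance (Y i) else 0))"
    unfolding sq_sum using prod by (simp add: Bochner_Integration.integral_sum)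
  also have "\<dots> = (\<Sum>i\<in>I. expectation (Y i))\<^sup>2 + (\<Sum>i\<in>I. variance (Y i))"
    using fin by (simp add: sum.distrib power2_eq_square sum_product sum.delta)
  finally show "variance (\<lambda>\<omega>. \<Sum>i\<in>I. Y i \<omega>) = (\<Sum>i\<in>I. variance (Y i))"
    using int int_sq by (subst variance_eq) (auto simp: Bochner_Integration.integral_sum)
qed

text \<open>Borel-Cantelli is applied at each threshold \<open>1 / Suc k\<close>; countably many
  thresholds leave a single null set.\<close>

lemma AE_tendsto_of_summable_deviation:
  fixes T :: "nat \<Rightarrow> 'a \<Rightarrow> real"
  assumes meas: "\<And>n. random_variable borel (T n)"
    and "\<And>e. 0 < e \<Longrightarrow> summable (\<lambda>n. prob {\<omega> \<in> space M. e \<le> \<bar>T n \<omega>\<bar>})"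
  shows "AE \<omega> in M. (\<lambda>n. T n \<omega>) \<longlonglongrightarrow> 0"
proof -
  have [measurable]: "T n \<in> borel_measurable M" for n by (rule meas)
  have "AE \<omega> in M. \<forall>k::nat. eventually (\<lambda>n. \<omega> \<in> space M - {\<omega> \<in> space M. 1 / real (Suc k) \<le> \<bar>T n \<omega>\<bar>}) sequentially"
    unfolding AE_all_countable
    by (intro allI borel_cantelli_AE1 assms(2)) (auto simp: emeasure_eq_measure)
  then show ?thesis
  proof (eventually_elim)
    case (elim \<omega>)
    show ?case
    proof (rule tendstoI)
      fix e :: real assume "0 < e"
      then obtain k where k: "1 / real (Suc k) < e"
        using reals_Archimedean by (metis inverse_eq_divide)
      show "eventually (\<lambda>n. dist (T n \<omega>) 0 < e) sequentially"
        using elim[rule_format, of k] by eventually_elim (use k in auto)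
    qed
  qed
qed


text \<open>Three limits are combined: the centred truncated sums vanish relative to
  \<open>a ^ n\<close>, almost surely only finitely many rows are changed by truncation, and the
  truncated means approach the true mean. The level \<open>a ^ n\<close> is common to row
  \<open>n\<close>, so each row stays identically distributed.\<close>

lemma strong_law_geometric_subseq:
  fixes X :: "nat \<Rightarrow> 'a \<Rightarrow> real"
  assumes a: "1 < a"
    and rv [measurable]: "\<And>i. random_variable borel (X i)"
    and indep: "\<And>i j. i \<noteq> j \<Longrightarrow> indep_var borel (X i) borel (X j)"
    and law: "\<And>i. distr M borel (X i) = distr M borel (X 0)"
    and int: "integrable M (X 0)"
    and nonneg: "\<And>i \<omega>. 0 \<le> X i \<omega>"
  shows "AE \<omega> in M. (\<lambda>n. (\<Sum>i<nat \<lfloor>a ^ n\<rfloor>. X i \<omega>) / a ^ n) \<longlonglongrightarrow> expectation (X 0)"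
proof -
  define m where "m n = nat \<lfloor>a ^ n\<rfloor>" for n
  define Y where "Y n i \<omega> = X i \<omega> * indicator {..a ^ n} (X i \<omega>)" for n i \<omega>
  define T where "T n \<omega> = ((\<Sum>i<m n. Y n i \<omega>) - expectation (\<lambda>\<omega>. \<Sum>i<m n. Y n i \<omega>)) / a ^ n" for n \<omega>
  have an: "0 < a ^ n" "1 \<le> a ^ n" for n using a by auto
  have m_le: "real (m n) \<le> a ^ n" and m_gt: "a ^ n - 1 < real (m n)" for n
    unfolding m_def using an[of n] by linarith+
  have Y_meas [measurable]: "Y n i \<in> borel_measurable M" for n i
    unfolding Y_def by measurable
  have T_meas [measurable]: "T n \<in> borel_measurable M" for n
    unfolding T_def by measurable
  have same: "expectation (\<lambda>\<omega>. g (X i \<omega>)) = expectation (\<lambda>\<omega>. g (X 0 \<omega>))"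
    if [measurable]: "g \<in> borel_measurable borel" for g :: "real \<Rightarrow> real" and i
    using integral_distr[of "X i" M borel g] integral_distr[of "X 0" M borel g] law[of i] by simp
  have Y_bound: "0 \<le> Y n i \<omega>" "Y n i \<omega> \<le> a ^ n" "Y n i \<omega> \<le> X i \<omega>" for n i \<omega>
    using nonneg[of i \<omega>] an[of n] by (auto simp: Y_def indicator_def)
  have Y_int: "integrable M (Y n i)" for n i
    by (rule integrable_const_bound[where B="a ^ n"]) (use Y_bound in auto)
  have Y_sq: "integrable M (\<lambda>\<omega>. (Y n i \<omega>)\<^sup>2)" for n i
    by (rule integrable_const_bound[where B="(a ^ n)\<^sup>2"])
       (use Y_bound in \<open>auto intro!: power_mono\<close>)
  have Y_indep: "indep_var borel (Y n i) borel (Y n j)" if "i \<noteq> j" for n i j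
    using indep_var_compose[OF indep[OF that], of "\<lambda>x. x * indicator {..a ^ n} x" borel
        "\<lambda>x. x * indicator {..a ^ n} x" borel]
    by (simp add: Y_def[abs_def] comp_def)

  have summable_sq: "summable (\<lambda>n. expectation (\<lambda>\<omega>. (Y n 0 \<omega>)\<^sup>2 / a ^ n))"
  proof (rule summableI_nonneg_bounded)
    show "0 \<le> expectation (\<lambda>\<omega>. (Y n 0 \<omega>)\<^sup>2 / a ^ n)" for n
      using an[of n] by (intro Bochner_Integration.integral_nonneg) auto
    fix n
    have "(\<Sum>k<n. expectation (\<lambda>\<omega>. (Y k 0 \<omega>)\<^sup>2 / a ^ k)) = expectation (\<lambda>\<omega>. \<Sum>k<n. (Y k 0 \<omega>)\<^sup>2 / a ^ k)"
      using Y_sq by (intro Bochner_Integration.integral_sum[symmetric]) simp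
    also have "\<dots> \<le> expectation (\<lambda>\<omega>. a * X 0 \<omega> / (a - 1))"
    proof (rule integral_mono)
      show "integrable M (\<lambda>\<omega>. \<Sum>k<n. (Y k 0 \<omega>)\<^sup>2 / a ^ k)"
        using Y_sq by (intro Bochner_Integration.integrable_sum) simp
      show "(\<Sum>k<n. (Y k 0 \<omega>)\<^sup>2 / a ^ k) \<le> a * X 0 \<omega> / (a - 1)" for \<omega>
        unfolding Y_def by (rule sum_geometric_above_le[OF a nonneg])
    qed (use int in simp)
    finally show "(\<Sum>k<n. expectation (\<lambda>\<omega>. (Y k 0 \<omega>)\<^sup>2 / a ^ k)) \<le> expectation (\<lambda>\<omega>. a * X 0 \<omega> / (a - 1))" .
  qed
  have dev: "AE \<omega> in M. (\<lambda>n. T n \<omega>) \<longlonglongrightarrow> 0"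
  proof (rule AE_tendsto_of_summable_deviation)
    fix e :: real assume e: "0 < e"
    \<comment> \<open>Chebyshev bounds the probability by at most \<open>a ^ n\<close> second
      moments over \<open>(e * a ^ n)\<^sup>2\<close>; one power of \<open>a ^ n\<close> cancels and
      leaves the series in \<open>summable_sq\<close>.\<close>
    show "summable (\<lambda>n. prob {\<omega> \<in> space M. e \<le> \<bar>T n \<omega>\<bar>})"
    proof (rule summable_comparison_test[OF _ summable_mult[OF summable_sq, of "1 / e\<^sup>2"]],
        intro exI allI impI)
      fix n
      let ?Z = "\<lambda>\<omega>. \<Sum>i<m n. Y n i \<omega>"
      have "{\<omega> \<in> space M. e \<le> \<bar>T n \<omega>\<bar>} = {\<omega> \<in> space M. e * a ^ n \<le> \<bar>?Z \<omega> - expectation ?Z\<bar>}"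
        using an[of n] by (simp add: T_def pos_le_divide_eq)
      then have "prob {\<omega> \<in> space M. e \<le> \<bar>T n \<omega>\<bar>} = prob {\<omega> \<in> space M. e * a ^ n \<le> \<bar>?Z \<omega> - expectation ?Z\<bar>}"
        by simp
      also have "\<dots> \<le> variance ?Z / (e * a ^ n)\<^sup>2"
      proof (rule Chebyshev_inequality)
        show "integrable M (\<lambda>\<omega>. (?Z \<omega>)\<^sup>2)"
          by (rule variance_sum_indep(1)) (auto intro: Y_indep Y_int Y_sq)
      qed (use e an[of n] in auto)
      also have "variance ?Z = (\<Sum>i<m n. variance (Y n i))"
        by (rule variance_sum_indep(2)) (auto intro: Y_indep Y_int Y_sq)
      also have "(\<Sum>i<m n. variance (Y n i)) \<le> (\<Sum>i<m n. expectation (\<lambda>\<omega>. (Y n 0 \<omega>)\<^sup>2))"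
      proof (rule sum_mono)
        fix i
        have "variance (Y n i) \<le> expectation (\<lambda>\<omega>. (Y n i \<omega>)\<^sup>2)"
          using variance_eq[OF Y_int[of n i] Y_sq[of n i]] by simp
        also have "\<dots> = expectation (\<lambda>\<omega>. (Y n 0 \<omega>)\<^sup>2)"
          unfolding Y_def by (rule same[of "\<lambda>x. (x * indicator {..a ^ n} x)\<^sup>2"]) measurable
        finally show "variance (Y n i) \<le> expectation (\<lambda>\<omega>. (Y n 0 \<omega>)\<^sup>2)" .
      qed
      also have "(\<Sum>i<m n. expectation (\<lambda>\<omega>. (Y n 0 \<omega>)\<^sup>2)) \<le> a ^ n * expectation (\<lambda>\<omega>. (Y n 0 \<omega>)\<^sup>2)"
        using m_le[of n] by (simp add: mult_right_mono)
      also have "a ^ n * expectation (\<lambda>\<omega>. (Y n 0 \<omega>)\<^sup>2) / (e * a ^ n)\<^sup>2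
          = 1 / e\<^sup>2 * expectation (\<lambda>\<omega>. (Y n 0 \<omega>)\<^sup>2 / a ^ n)"
        using an(1)[of n] e by (simp add: power2_eq_square)
      finally show "norm (prob {\<omega> \<in> space M. e \<le> \<bar>T n \<omega>\<bar>})
          \<le> 1 / e\<^sup>2 * expectation (\<lambda>\<omega>. (Y n 0 \<omega>)\<^sup>2 / a ^ n)"
        using e by (simp add: divide_right_mono)
    qed
  qed measurable

  \<comment> \<open>\<open>A n\<close> is the event that truncation changes row \<open>n\<close>.
    The union bound over its \<open>m n \<le> a ^ n\<close> entries gives at most the expectation of
    \<open>?h n\<close>.\<close>
  define A where "A n = {\<omega> \<in> space M. \<exists>i\<in>{..<m n}. a ^ n < X i \<omega>}" for n
  have A_sets [measurable]: "A n \<in> sets M" for n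
    unfolding A_def by measurable
  let ?h = "\<lambda>n \<omega>. a ^ n * indicator {a ^ n<..} (X 0 \<omega>)"
  have h_int: "integrable M (?h n)" for n
    by (rule integrable_const_bound[where B="a ^ n"]) (use a in \<open>auto simp: indicator_def\<close>)
  have summable_A: "summable (\<lambda>n. prob (A n))"
  proof (rule summable_comparison_test)
    show "summable (\<lambda>n. expectation (?h n))"
    proof (rule summableI_nonneg_bounded)
      show "0 \<le> expectation (?h n)" for n
        using an[of n] by (intro Bochner_Integration.integral_nonneg) auto
      fix n
      have "(\<Sum>k<n. expectation (?h k)) = expectation (\<lambda>\<omega>. \<Sum>k<n. ?h k \<omega>)"
        using h_int by (intro Bochner_Integration.integral_sum[symmetric])
      also have "\<dots> \<le> expectation (\<lambda>\<omega>. a * X 0 \<omega> / (a - 1))"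
      proof (rule integral_mono)
        show "integrable M (\<lambda>\<omega>. \<Sum>k<n. ?h k \<omega>)"
          using h_int by (intro Bochner_Integration.integrable_sum)
        show "(\<Sum>k<n. ?h k \<omega>) \<le> a * X 0 \<omega> / (a - 1)" for \<omega>
          by (rule sum_geometric_below_le[OF a nonneg])
      qed (use int in simp)
      finally show "(\<Sum>k<n. expectation (?h k)) \<le> expectation (\<lambda>\<omega>. a * X 0 \<omega> / (a - 1))" .
    qed
    show "\<exists>N. \<forall>n\<ge>N. norm (prob (A n)) \<le> expectation (?h n)"
    proof (intro exI allI impI)
      fix n
      have "A n = (\<Union>i<m n. {\<omega> \<in> space M. a ^ n < X i \<omega>})"
        by (auto simp: A_def)
      then have "prob (A n) \<le> (\<Sum>i<m n. prob {\<omega> \<in> space M. a ^ n < X i \<omega>})"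
        by (simp only:) (rule finite_measure_subadditive_finite, auto)
      also have "\<dots> = (\<Sum>i<m n. expectation (\<lambda>\<omega>. indicator {a ^ n<..} (X 0 \<omega>)))"
      proof (rule sum.cong[OF refl])
        fix i
        have "prob {\<omega> \<in> space M. a ^ n < X i \<omega>} = expectation (indicator {\<omega> \<in> space M. a ^ n < X i \<omega>})"
          by simp
        also have "\<dots> = expectation (\<lambda>\<omega>. indicator {a ^ n<..} (X i \<omega>))"
          by (rule Bochner_Integration.integral_cong) (auto simp: indicator_def)
        also have "\<dots> = expectation (\<lambda>\<omega>. indicator {a ^ n<..} (X 0 \<omega>))"
          by (rule same) measurable
        finally show "prob {\<omega> \<in> space M. a ^ n < X i \<omega>} = expectation (\<lambda>\<omega>. indicator {a ^ n<..} (X 0 \<omega>))" .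
      qed
      also have "\<dots> \<le> a ^ n * expectation (\<lambda>\<omega>. indicator {a ^ n<..} (X 0 \<omega>))"
        using m_le[of n] by (simp add: mult_right_mono)
      finally show "norm (prob (A n)) \<le> expectation (?h n)"
        by simp
    qed
  qed
  have trunc: "AE \<omega> in M. eventually (\<lambda>n. \<omega> \<in> space M - A n) sequentially"
    using summable_A by (intro borel_cantelli_AE1) (auto simp: emeasure_eq_measure)

  have mean: "(\<lambda>n. expectation (\<lambda>\<omega>. \<Sum>i<m n. Y n i \<omega>) / a ^ n) \<longlonglongrightarrow> expectation (X 0)"
  proof -
    have "(\<lambda>n. expectation (Y n 0)) \<longlonglongrightarrow> expectation (X 0)"
    proof (rule integral_dominated_convergence[where w="X 0"])
      show "AE \<omega> in M. (\<lambda>n. Y n 0 \<omega>) \<longlonglongrightarrow> X 0 \<omega>"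
      proof (rule AE_I2)
        fix \<omega>
        obtain k where k: "X 0 \<omega> < a ^ k" using real_arch_pow[OF a] by blast
        have "X 0 \<omega> \<le> a ^ n" if "n \<ge> k" for n
          using k power_increasing[OF that, of a] a by linarith
        then have "eventually (\<lambda>n. Y n 0 \<omega> = X 0 \<omega>) sequentially"
          unfolding eventually_sequentially Y_def by (intro exI[of _ k]) simp
        then show "(\<lambda>n. Y n 0 \<omega>) \<longlonglongrightarrow> X 0 \<omega>" by (rule tendsto_eventually)
      qed
    qed (use int Y_bound nonneg in auto)
    \<comment> \<open>The floor loses less than 1, so normalising by \<open>a ^ n\<close> instead of
      the number of summands does not change the limit.\<close>
    moreover have "(\<lambda>n. real (m n) / a ^ n) \<longlonglongrightarrow> 1"
    proof (rule tendsto_sandwich)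
      have "(\<lambda>n. (1 / a) ^ n) \<longlonglongrightarrow> 0" using a by (intro LIMSEQ_realpow_zero) auto
      then show "(\<lambda>n. 1 - (1 / a) ^ n) \<longlonglongrightarrow> 1"
        using tendsto_diff[OF tendsto_const, of "\<lambda>n. (1 / a) ^ n" 0 sequentially 1] by simp
      show "eventually (\<lambda>n. 1 - (1 / a) ^ n \<le> real (m n) / a ^ n) sequentially"
      proof (rule always_eventually, rule allI)
        fix n
        have "1 - (1 / a) ^ n = (a ^ n - 1) / a ^ n" using a
          by (simp add: power_one_over diff_divide_distrib)
        also have "\<dots> \<le> real (m n) / a ^ n"
          using m_gt[of n] an[of n] by (intro divide_right_mono) auto
        finally show "1 - (1 / a) ^ n \<le> real (m n) / a ^ n" .
      qed
      show "eventually (\<lambda>n. real (m n) / a ^ n \<le> 1) sequentially"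
        using m_le an by (intro always_eventually) simp
    qed simp
    ultimately have "(\<lambda>n. real (m n) / a ^ n * expectation (Y n 0)) \<longlonglongrightarrow> 1 * expectation (X 0)"
      by (intro tendsto_mult)
    moreover have "expectation (\<lambda>\<omega>. \<Sum>i<m n. Y n i \<omega>) / a ^ n = real (m n) / a ^ n * expectation (Y n 0)" for n
    proof -
      have "expectation (Y n i) = expectation (Y n 0)" for i
        unfolding Y_def by (rule same) measurable
      then have "(\<Sum>i<m n. expectation (Y n i)) = (\<Sum>i<m n. expectation (Y n 0))"
        by (intro sum.cong refl)
      then show ?thesis
        using Y_int by (simp add: Bochner_Integration.integral_sum)
    qed
    ultimately show ?thesis by (simp only: mult_1)
  qed
  show ?thesis
    using dev trunc
  proof eventually_elim
    case (elim \<omega>)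
    have "(\<lambda>n. T n \<omega> + expectation (\<lambda>\<omega>. \<Sum>i<m n. Y n i \<omega>) / a ^ n) \<longlonglongrightarrow> 0 + expectation (X 0)"
      by (intro tendsto_add elim mean)
    moreover have "eventually (\<lambda>n. T n \<omega> + expectation (\<lambda>\<omega>. \<Sum>i<m n. Y n i \<omega>) / a ^ n =
        (\<Sum>i<nat \<lfloor>a ^ n\<rfloor>. X i \<omega>) / a ^ n) sequentially"
      using elim(2)
    proof eventually_elim
      case (elim n)
      then have "Y n i \<omega> = X i \<omega>" if "i < m n" for i
        using that by (auto simp: A_def Y_def indicator_def not_less)
      then have "(\<Sum>i<m n. Y n i \<omega>) = (\<Sum>i<m n. X i \<omega>)"
        by (intro sum.cong) auto
      then show ?case by (simp add: T_def diff_divide_distrib m_def)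
    qed
    ultimately show ?case by (simp add: tendsto_cong)
  qed
qed

text \<open>Nonnegativity makes the partial sums monotone, which lets the geometric subsequences
  control all indices in between.\<close>

theorem strong_law_of_large_numbers_nonneg:
  fixes X :: "nat \<Rightarrow> 'a \<Rightarrow> real"
  assumes rv: "\<And>i. random_variable borel (X i)"
    and indep: "\<And>i j. i \<noteq> j \<Longrightarrow> indep_var borel (X i) borel (X j)"
    and law: "\<And>i. distr M borel (X i) = distr M borel (X 0)"
    and int: "integrable M (X 0)"
    and nonneg: "\<And>i \<omega>. 0 \<le> X i \<omega>"
  shows "AE \<omega> in M. (\<lambda>n. (\<Sum>i<n. X i \<omega>) / real n) \<longlonglongrightarrow> expectation (X 0)"
proof -
  have "AE \<omega> in M. \<forall>k. (\<lambda>n. (\<Sum>i<nat \<lfloor>(1 + 1 / real (Suc k)) ^ n\<rfloor>. X i \<omega>) / (1 + 1 / real (Suc k)) ^ n)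
      \<longlonglongrightarrow> expectation (X 0)"
    unfolding AE_all_countable
    by (intro allI strong_law_geometric_subseq rv indep law int nonneg) simp_all
  then show ?thesis
  proof eventually_elim
    case (elim \<omega>)
    show ?case
    proof (rule lim_average_of_geometric_subseq)
      show "mono (\<lambda>n. \<Sum>i<n. X i \<omega>)"
        by (intro monoI sum_mono2) (auto simp: nonneg)
      show "0 \<le> (\<Sum>i<n. X i \<omega>)" for n
        by (intro sum_nonneg nonneg)
    qed (use elim in blast)
  qed
qed

end

section \<open>Minimisers of pointwise convergent convex functions\<close>

text \<open>A convex function is bounded on a convex hull by its maximum over the generating points,
  so limits at the finitely many points of \<open>K\<close> bound a sequence of convex functions on
  a whole ball. The vertices of a cube serve as \<open>K\<close>; its half side
  \<open>\<bar>r\<bar> + 1\<close> is positive for every \<open>r\<close>.\<close>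

lemma cball_subset_finite_convex_hull:
  fixes x :: "'a::euclidean_space"
  obtains K where "finite K" "cball x r \<subseteq> convex hull K"
proof -
  let ?d = "\<bar>r\<bar> + 1"
  obtain K where K: "finite K"
      "cbox (x - (\<Sum>i\<in>Basis. ?d *\<^sub>R i)) (x + (\<Sum>i\<in>Basis. ?d *\<^sub>R i)) = convex hull K"
    by (rule cube_convex_hull[of ?d x]) auto
  have "y \<in> convex hull K" if "y \<in> cball x r" for y
    unfolding K(2)[symmetric] mem_box
  proof
    fix i :: 'a assume i: "i \<in> Basis"
    have "\<bar>(y - x) \<bullet> i\<bar> \<le> norm (y - x)" using i by (rule Basis_le_norm)
    also have "\<dots> \<le> r" using that by (simp add: dist_norm norm_minus_commute)
    finally show "(x - (\<Sum>i\<in>Basis. ?d *\<^sub>R i)) \<bullet> i \<le> y \<bullet> i \<and> y \<bullet> i \<le> (x + (\<Sum>i\<in>Basis. ?d *\<^sub>R i)) \<bullet> i"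
      using i by (simp add: inner_simps inner_sum_left_Basis) linarith
  qed
  with K(1) that show thesis by blast
qed

text \<open>The points of \<open>K\<close> yield a common upper bound on \<open>cball x 2\<close>;
  convexity together with this bound substitutes for uniform convergence near a cluster
  point.\<close>

lemma argmin_tendsto_of_convex:
  fixes f :: "'a::euclidean_space \<Rightarrow> real" and g :: "nat \<Rightarrow> 'a \<Rightarrow> real"
  assumes cont: "continuous_on UNIV f"
    and conv: "eventually (\<lambda>N. convex_on UNIV (g N)) sequentially"
    and dense: "\<And>U. open U \<Longrightarrow> U \<noteq> {} \<Longrightarrow> \<exists>q\<in>D. q \<in> U"
    and K: "finite K" "cball x 2 \<subseteq> convex hull K"
    and lim: "\<And>q. q \<in> insert x (D \<union> K) \<Longrightarrow> (\<lambda>N. g N q) \<longlonglongrightarrow> f q"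
    and min: "\<And>v. v \<noteq> x \<Longrightarrow> f x < f v"
    and y: "eventually (\<lambda>N. \<forall>v. g N (y N) \<le> g N v) sequentially"
  shows "y \<longlonglongrightarrow> x"
proof (rule ccontr)
  assume "\<not> y \<longlonglongrightarrow> x"
  then obtain e where e: "0 < e" "\<not> eventually (\<lambda>N. dist (y N) x < e) sequentially"
    unfolding tendsto_iff by blast
  \<comment> \<open>\<open>r \<le> e\<close> puts the stray minimisers on or outside the sphere;
    \<open>r \<le> 1\<close> keeps points within distance 1 of the sphere inside
    \<open>cball x 2\<close>, where the bound \<open>B + 1\<close> holds.\<close>
  define r where "r = Min {e, 1}"
  have r: "0 < r" "r \<le> e" "r \<le> 1" using e by (auto simp: r_def)
  have "bdd_above (f ` K)" using K(1) by simp
  then obtain B where B: "\<And>k. k \<in> K \<Longrightarrow> f k \<le> B" by (auto simp: bdd_above_def)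
  have "eventually (\<lambda>N. \<forall>k\<in>K. g N k < B + 1) sequentially"
  proof (rule eventually_ball_finite[OF K(1)], rule ballI)
    fix k assume "k \<in> K"
    then have "(\<lambda>N. g N k) \<longlonglongrightarrow> f k" "f k < B + 1" using lim B[of k] by auto
    then show "eventually (\<lambda>N. g N k < B + 1) sequentially" by (simp add: order_tendstoD)
  qed
  with conv have bound: "eventually (\<lambda>N. \<forall>w\<in>cball x 2. g N w \<le> B + 1) sequentially"
  proof eventually_elim
    case (elim N)
    then have "\<forall>w\<in>convex hull K. g N w \<le> B + 1"
      by (intro convex_on_convex_hull_bound)
         (auto intro: convex_on_subset less_imp_le)
    then show ?case using K(2) by blast
  qed
  have "\<exists>N\<ge>n. e \<le> dist (y N) x" for n
    using e(2) unfolding eventually_sequentially by (metis not_less)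
  then have "infinite {N. e \<le> dist (y N) x}"
    unfolding infinite_nat_iff_unbounded_le by blast
  then obtain s :: "nat \<Rightarrow> nat" where s: "strict_mono s" "\<And>n. e \<le> dist (y (s n)) x"
    using infinite_enumerate by blast
  define c where "c n = r / dist (y (s n)) x" for n
  define v where "v n = (1 - c n) *\<^sub>R x + c n *\<^sub>R y (s n)" for n
  have d_pos: "0 < dist (y (s n)) x" for n using s(2)[of n] e by linarith
  have c: "0 \<le> c n" "c n \<le> 1" for n
    using d_pos[of n] s(2)[of n] r unfolding c_def by (auto simp: divide_le_eq)
  have "v n - x = c n *\<^sub>R (y (s n) - x)" for n
    by (simp add: v_def algebra_simps)
  then have v_dist: "dist x (v n) = r" for n
    using d_pos[of n] r c[of n] by (simp add: dist_norm c_def norm_minus_commute[of x])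
  then have "\<forall>n. v n \<in> sphere x r" by simp
  then obtain l t where l: "l \<in> sphere x r" and t: "strict_mono t" and vt: "(v \<circ> t) \<longlonglongrightarrow> l"
    using seq_compactE[OF compact_imp_seq_compact[OF compact_sphere]] by blast
  have sub: "filterlim (s \<circ> t) sequentially sequentially"
    using s(1) t by (intro filterlim_subseq strict_mono_o)
  \<comment> \<open>Convergence is given only on \<open>insert x (D \<union> K)\<close>, which may
    miss \<open>l\<close>, so the comparison is made at nearby points of \<open>D\<close>, at a
    price proportional to \<open>\<tau>\<close>.\<close>
  have below: "f q \<le> (1 - \<tau>) * f x + \<tau> * (B + 1)"
    if q: "q \<in> D" and \<tau>: "0 < \<tau>" "\<tau> < 1" and ql: "dist q l < \<tau> / 2" for q \<tau>
  proof (rule tendsto_le[OF sequentially_bot])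
    show "(\<lambda>n. g ((s \<circ> t) n) q) \<longlonglongrightarrow> f q"
      using q by (intro filterlim_compose[OF _ sub] lim) auto
    show "(\<lambda>n. (1 - \<tau>) * g ((s \<circ> t) n) x + \<tau> * (B + 1)) \<longlonglongrightarrow> (1 - \<tau>) * f x + \<tau> * (B + 1)"
      by (intro tendsto_intros filterlim_compose[OF _ sub] lim) auto
    have near: "eventually (\<lambda>n. dist ((v \<circ> t) n) l < \<tau> / 2) sequentially"
      using tendstoD[OF vt, of "\<tau> / 2"] \<tau> by simp
    have ev: "eventually (\<lambda>n. convex_on UNIV (g ((s \<circ> t) n)) \<and>
        (\<forall>w\<in>cball x 2. g ((s \<circ> t) n) w \<le> B + 1) \<and>
        (\<forall>w. g ((s \<circ> t) n) (y ((s \<circ> t) n)) \<le> g ((s \<circ> t) n) w)) sequentially"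
      by (rule eventually_compose_filterlim[OF _ sub]) (intro eventually_conj conv bound y)
    from ev near show "eventually (\<lambda>n. g ((s \<circ> t) n) q \<le> (1 - \<tau>) * g ((s \<circ> t) n) x + \<tau> * (B + 1)) sequentially"
    proof eventually_elim
      case (elim n)
      let ?g = "g ((s \<circ> t) n)" and ?v = "(v \<circ> t) n"
      \<comment> \<open>\<open>w\<close> prolongs the segment from \<open>?v\<close> to
        \<open>q\<close> by the factor \<open>1 / \<tau>\<close>. Since
        \<open>dist q ?v \<le> \<tau>\<close>, it stays within distance 1 of \<open>?v\<close>, and
        \<open>q\<close> combines \<open>?v\<close> and \<open>w\<close> with weights
        \<open>1 - \<tau>\<close> and \<open>\<tau>\<close>.\<close>
      define w where "w = ?v + (1 / \<tau>) *\<^sub>R (q - ?v)"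
      have conv_g: "convex_on UNIV ?g" and ball: "\<And>w. w \<in> cball x 2 \<Longrightarrow> ?g w \<le> B + 1"
        and opt: "\<And>w. ?g (y ((s \<circ> t) n)) \<le> ?g w"
        using elim by blast+
      have "dist q ?v \<le> \<tau>"
        using elim ql dist_triangle[of q ?v l] by (simp add: dist_commute)
      then have "dist ?v w \<le> 1"
        using \<tau> by (simp add: w_def dist_norm norm_minus_commute divide_le_eq)
      moreover have "dist x ?v \<le> 1" using v_dist[of "t n"] r by simp
      ultimately have w: "?g w \<le> B + 1"
        using dist_triangle[of x w ?v] by (intro ball) simp
      have "?g ?v \<le> (1 - c (t n)) * ?g x + c (t n) * ?g (y ((s \<circ> t) n))"
        unfolding v_def comp_def using conv_g c
        by (intro convex_onD[where A=UNIV]) (auto simp: comp_def)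
      also have "\<dots> \<le> (1 - c (t n)) * ?g x + c (t n) * ?g x"
        using c opt by (intro add_left_mono mult_left_mono) auto
      finally have v: "?g ?v \<le> ?g x" by (simp add: algebra_simps)
      have "q = (1 - \<tau>) *\<^sub>R ?v + \<tau> *\<^sub>R w"
        using \<tau> by (simp add: w_def algebra_simps)
      then have "?g q \<le> (1 - \<tau>) * ?g ?v + \<tau> * ?g w"
        using convex_onD[OF conv_g, of \<tau> ?v w] \<tau> by simp
      also have "\<dots> \<le> (1 - \<tau>) * ?g x + \<tau> * (B + 1)"
        using v w \<tau> by (intro add_mono mult_left_mono) auto
      finally show ?case .
    qed
  qed
  \<comment> \<open>Continuity of \<open>f\<close> carries the bound from \<open>D\<close> to
    \<open>l\<close>: otherwise it would fail on a nonempty open set near \<open>l\<close>, which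
    contains a point of \<open>D\<close>.\<close>
  have at_l: "f l \<le> (1 - \<tau>) * f x + \<tau> * (B + 1)" if \<tau>: "0 < \<tau>" "\<tau> < 1" for \<tau>
  proof (rule ccontr)
    let ?b = "(1 - \<tau>) * f x + \<tau> * (B + 1)"
    assume "\<not> f l \<le> ?b"
    then have "?b < f l" by simp
    moreover have "open {z. ?b < f z}"
      using cont by (intro open_Collect_less continuous_intros)
    ultimately have "open ({z. ?b < f z} \<inter> ball l (\<tau> / 2))" "{z. ?b < f z} \<inter> ball l (\<tau> / 2) \<noteq> {}"
      using \<tau> by (auto intro!: exI[of _ l])
    then obtain q where "q \<in> D" "q \<in> {z. ?b < f z} \<inter> ball l (\<tau> / 2)"
      using dense by blast
    with below[of q \<tau>] \<tau> show False by (simp add: dist_commute)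
  qed
  have "f l \<le> f x"
  proof (rule tendsto_lowerbound)
    have "((\<lambda>\<tau>. (1 - \<tau>) * f x + \<tau> * (B + 1)) \<longlongrightarrow> (1 - 0) * f x + 0 * (B + 1)) (at_right 0)"
      by (intro tendsto_intros)
    then show "((\<lambda>\<tau>. (1 - \<tau>) * f x + \<tau> * (B + 1)) \<longlongrightarrow> f x) (at_right 0)" by simp
    show "eventually (\<lambda>\<tau>. f l \<le> (1 - \<tau>) * f x + \<tau> * (B + 1)) (at_right 0)"
      unfolding eventually_at_right_field using at_l by (intro exI[of _ 1]) auto
  qed simp
  moreover have "l \<noteq> x" using l r by auto
  ultimately show False using min[of l] by simp
qed

section \<open>Expectation of a randomised quadratic form\<close>

text \<open>Working with generated sigma-algebras leaves the value spaces free, as required when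
  vectors of different dimensions share one independent family.\<close>

lemma (in prob_space) indep_var_of_indep_sets:
  assumes indep: "indep_sets A I" and ij: "i \<in> I" "j \<in> I" "i \<noteq> j"
    and X: "random_variable N X" and Y: "random_variable L Y"
    and XA: "sets (vimage_algebra (space M) X N) \<subseteq> A i"
    and YA: "sets (vimage_algebra (space M) Y L) \<subseteq> A j"
  shows "indep_var N X L Y"
proof -
  have sigma: "sigma_sets (space M) {Z -` B \<inter> space M |B. B \<in> sets R} = sets (vimage_algebra (space M) Z R)"
    for R :: "'z measure" and Z
    by (simp add: sets_vimage_algebra)
  show ?thesis
    unfolding indep_var_eq sigma indep_sets2_eq
  proof (intro conjI ballI X Y)
    show "sets (vimage_algebra (space M) X N) \<subseteq> events" "sets (vimage_algebra (space M) Y L) \<subseteq> events"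
      using X Y by (auto simp: sets_vimage_algebra2 measurable_def)
    fix a b assume "a \<in> sets (vimage_algebra (space M) X N)" "b \<in> sets (vimage_algebra (space M) Y L)"
    then show "prob (a \<inter> b) = prob a * prob b"
      using indep_setsD[OF indep, of "{i, j}" "\<lambda>k. if k = i then a else b"] ij XA YA by (auto simp: Int_commute)
  qed
qed

lemma (in prob_space) indep_vars_imp_indep_var:
  assumes "indep_vars N X I" "i \<in> I" "j \<in> I" "i \<noteq> j"
  shows "indep_var (N i) (X i) (N j) (X j)"
  using assms unfolding indep_vars_def
  by (intro indep_var_of_indep_sets[OF _ assms(2-4)]) (auto simp: sets_vimage_algebra)

text \<open>The norm on matrices is the Frobenius norm, which is multiplicative on rank-one
  matrices; hence a finite second moment makes the outer product integrable.\<close>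

lemma norm_outer: "norm (outer x y) = norm x * norm y"
proof -
  have "norm (outer x y $ i) = norm (x $ i) * norm y" for i
  proof -
    have "outer x y $ i = (x $ i) *\<^sub>R y" by (simp add: outer_def vec_eq_iff)
    then show ?thesis by simp
  qed
  then show ?thesis
    by (simp add: norm_vec_def L2_set_left_distrib)
qed

lemma borel_measurable_outer [measurable]:
  assumes [measurable]: "X \<in> borel_measurable M" "Y \<in> borel_measurable M"
  shows "(\<lambda>\<omega>. outer (X \<omega>) (Y \<omega>)) \<in> borel_measurable M"
proof -
  have "continuous_on UNIV (\<lambda>z. outer (fst z) (snd z))"
    unfolding outer_def by (intro continuous_intros)
  then have "(\<lambda>z. outer (fst z) (snd z)) \<in> borel_measurable borel"
    by (rule borel_measurable_continuous_onI)
  from measurable_compose[OF _ this, of "\<lambda>\<omega>. (X \<omega>, Y \<omega>)" M] show ?thesis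
    by (simp add: borel_prod[symmetric])
qed

lemma borel_measurable_vec_nth [measurable (raw)]:
  fixes f :: "'a \<Rightarrow> real ^ 'm"
  assumes "f \<in> borel_measurable M"
  shows "(\<lambda>x. f x $ i) \<in> borel_measurable M"
  by (rule borel_measurable_continuous_on[OF _ assms]) (intro continuous_intros)

text \<open>In coordinates the square is a sum of products of a function of \<open>X\<close> and a
  function of \<open>Y\<close>, so expectations factor. Terms linear in \<open>Y\<close> vanish with
  its mean, and the last term is free of \<open>a\<close>: it is the source of the constant between
  the two objectives.\<close>

lemma (in prob_space) expectation_inner_shift_square:
  fixes X Y :: "'a \<Rightarrow> real ^ 'm"
  assumes indep: "indep_var borel X borel Y"
    and sqX: "integrable M (\<lambda>\<omega>. (norm (X \<omega>))\<^sup>2)" and sqY: "integrable M (\<lambda>\<omega>. (norm (Y \<omega>))\<^sup>2)"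
    and mean: "expectation Y = 0"
  shows "integrable M (\<lambda>\<omega>. (X \<omega> \<bullet> (a + Y \<omega>))\<^sup>2)"
    and "expectation (\<lambda>\<omega>. (X \<omega> \<bullet> (a + Y \<omega>))\<^sup>2) =
      weighted_norm_sq (expectation (\<lambda>\<omega>. outer (X \<omega>) (X \<omega>))) a + expectation (\<lambda>\<omega>. (X \<omega> \<bullet> Y \<omega>)\<^sup>2)"
proof -
  have [measurable]: "X \<in> borel_measurable M" "Y \<in> borel_measurable M"
    using indep by (auto simp: indep_var_eq)
  let ?C = "expectation (\<lambda>\<omega>. outer (X \<omega>) (X \<omega>))"
  have prod_int: "integrable M (\<lambda>\<omega>. Z \<omega> $ i * Z \<omega> $ j)"
    if sq: "integrable M (\<lambda>\<omega>. (norm (Z \<omega>))\<^sup>2)" and [measurable]: "Z \<in> borel_measurable M"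
    for Z :: "'a \<Rightarrow> real ^ 'm" and i j
  proof (rule Bochner_Integration.integrable_bound[OF sq])
    show "AE \<omega> in M. norm (Z \<omega> $ i * Z \<omega> $ j) \<le> norm ((norm (Z \<omega>))\<^sup>2)"
    proof (rule AE_I2)
      fix \<omega>
      have "\<bar>Z \<omega> $ i\<bar> * \<bar>Z \<omega> $ j\<bar> \<le> norm (Z \<omega>) * norm (Z \<omega>)"
        by (intro mult_mono component_le_norm_cart) auto
      then show "norm (Z \<omega> $ i * Z \<omega> $ j) \<le> norm ((norm (Z \<omega>))\<^sup>2)"
        by (simp add: abs_mult power2_eq_square)
    qed
  qed measurable
  \<comment> \<open>Integrability of \<open>Y\<close> comes first: the Bochner integral of a
    non-integrable function is 0 by default, so \<open>mean\<close> alone would say nothing about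
    the coordinates.\<close>
  have "integrable M (\<lambda>\<omega>. norm (Y \<omega>))"
    by (rule square_integrable_imp_integrable) (use sqY in auto)
  then have Y_int: "integrable M Y" by (simp add: integrable_norm_iff)
  have Yi_int: "integrable M (\<lambda>\<omega>. Y \<omega> $ i)" for i
    by (rule integrable_bounded_linear[OF bounded_linear_vec_nth Y_int])
  have Yi_mean: "expectation (\<lambda>\<omega>. Y \<omega> $ i) = 0" for i
    using integral_bounded_linear[OF bounded_linear_vec_nth Y_int, of i] mean by simp
  have outer_int: "integrable M (\<lambda>\<omega>. outer (X \<omega>) (X \<omega>))"
    by (rule Bochner_Integration.integrable_bound[OF sqX])
       (auto simp: norm_outer power2_eq_square)
  have C: "expectation (\<lambda>\<omega>. X \<omega> $ i * X \<omega> $ j) = ?C $ i $ j" for i j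
  proof -
    have "bounded_linear (\<lambda>A :: real ^ 'm ^ 'm. A $ i $ j)"
      using bounded_linear_compose[OF bounded_linear_vec_nth bounded_linear_vec_nth] .
    from integral_bounded_linear[OF this outer_int] show ?thesis
      by (simp add: outer_def)
  qed
  have expand: "(X \<omega> \<bullet> (b + Y \<omega>))\<^sup>2 =
      (\<Sum>i\<in>UNIV. \<Sum>j\<in>UNIV. (X \<omega> $ i * X \<omega> $ j) * ((b + Y \<omega>) $ i * (b + Y \<omega>) $ j))" for b \<omega>
    by (simp add: inner_vec_def power2_eq_square sum_product algebra_simps)
  have shift: "(b + Y \<omega>) $ i * (b + Y \<omega>) $ j = b $ i * b $ j + b $ i * Y \<omega> $ j + b $ j * Y \<omega> $ i + Y \<omega> $ i * Y \<omega> $ j"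
    for b \<omega> i j by (simp add: algebra_simps)
  have shift_int: "integrable M (\<lambda>\<omega>. (b + Y \<omega>) $ i * (b + Y \<omega>) $ j)" for b i j
    unfolding shift using Yi_int prod_int[OF sqY] by simp
  have shift_mean: "expectation (\<lambda>\<omega>. (b + Y \<omega>) $ i * (b + Y \<omega>) $ j) =
      b $ i * b $ j + expectation (\<lambda>\<omega>. Y \<omega> $ i * Y \<omega> $ j)" for b i j
    unfolding shift using Yi_int prod_int[OF sqY] by (simp add: Yi_mean prob_space)
  have term_indep: "indep_var borel (\<lambda>\<omega>. X \<omega> $ i * X \<omega> $ j) borel (\<lambda>\<omega>. (b + Y \<omega>) $ i * (b + Y \<omega>) $ j)" for b i j
    using indep_var_compose[OF indep, of "\<lambda>x. x $ i * x $ j" borel "\<lambda>y. (b + y) $ i * (b + y) $ j" borel]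
    by (simp add: comp_def)
  note term_int = indep_var_integrable[OF term_indep prod_int[OF sqX] shift_int]
  note term_mean = indep_var_lebesgue_integral[OF term_indep prod_int[OF sqX] shift_int]
  show "integrable M (\<lambda>\<omega>. (X \<omega> \<bullet> (a + Y \<omega>))\<^sup>2)"
    unfolding expand by (intro Bochner_Integration.integrable_sum term_int) measurable
  \<comment> \<open>Kept general in \<open>b\<close>, since \<open>b = 0\<close> identifies the
    second double sum as the expectation of
    \<open>(X \<omega> \<bullet> Y \<omega>)\<^sup>2\<close>.\<close>
  have formula: "expectation (\<lambda>\<omega>. (X \<omega> \<bullet> (b + Y \<omega>))\<^sup>2) =
      (\<Sum>i\<in>UNIV. \<Sum>j\<in>UNIV. ?C $ i $ j * (b $ i * b $ j)) +
      (\<Sum>i\<in>UNIV. \<Sum>j\<in>UNIV. ?C $ i $ j * expectation (\<lambda>\<omega>. Y \<omega> $ i * Y \<omega> $ j))" for b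
  proof -
    have "expectation (\<lambda>\<omega>. (X \<omega> \<bullet> (b + Y \<omega>))\<^sup>2) =
        (\<Sum>i\<in>UNIV. \<Sum>j\<in>UNIV. expectation (\<lambda>\<omega>. (X \<omega> $ i * X \<omega> $ j) * ((b + Y \<omega>) $ i * (b + Y \<omega>) $ j)))"
      unfolding expand
      by (subst Bochner_Integration.integral_sum, intro Bochner_Integration.integrable_sum term_int, measurable,
          intro sum.cong refl Bochner_Integration.integral_sum term_int, measurable)
    also have "\<dots> = (\<Sum>i\<in>UNIV. \<Sum>j\<in>UNIV. ?C $ i $ j * (b $ i * b $ j + expectation (\<lambda>\<omega>. Y \<omega> $ i * Y \<omega> $ j)))"
      by (simp only: term_mean[OF \<open>X \<in> borel_measurable M\<close>] shift_mean C)
    finally show ?thesis by (simp add: distrib_left sum.distrib)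
  qed
  have quad: "weighted_norm_sq ?C a = (\<Sum>i\<in>UNIV. \<Sum>j\<in>UNIV. ?C $ i $ j * (a $ i * a $ j))"
    by (simp add: weighted_norm_sq_def inner_vec_def matrix_vector_mult_def sum_distrib_left mult_ac)
  show "expectation (\<lambda>\<omega>. (X \<omega> \<bullet> (a + Y \<omega>))\<^sup>2) =
      weighted_norm_sq ?C a + expectation (\<lambda>\<omega>. (X \<omega> \<bullet> Y \<omega>)\<^sup>2)"
    using formula[of a] formula[of 0] by (simp add: quad)
qed

section \<open>Consistency of sample average minimisers\<close>

text \<open>Provides continuity of the limit objective, as a real-valued convex function on a
  Euclidean space is continuous.\<close>

lemma convex_on_expectation:
  fixes h :: "'b \<Rightarrow> 'e::real_vector \<Rightarrow> real"
  assumes int: "\<And>u. integrable \<pi> (\<lambda>x. h x u)"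
    and conv: "AE x in \<pi>. convex_on UNIV (h x)"
  shows "convex_on UNIV (\<lambda>u. \<integral>x. h x u \<partial>\<pi>)"
proof (rule convex_onI)
  fix t :: real and u v :: 'e
  assume t: "0 < t" "t < 1"
  have "(\<integral>x. h x ((1 - t) *\<^sub>R u + t *\<^sub>R v) \<partial>\<pi>) \<le> (\<integral>x. (1 - t) * h x u + t * h x v \<partial>\<pi>)"
  proof (rule integral_mono_AE)
    show "AE x in \<pi>. h x ((1 - t) *\<^sub>R u + t *\<^sub>R v) \<le> (1 - t) * h x u + t * h x v"
      using conv by eventually_elim (use t in \<open>auto intro: convex_onD\<close>)
  qed (use int in auto)
  then show "(\<integral>x. h x ((1 - t) *\<^sub>R u + t *\<^sub>R v) \<partial>\<pi>) \<le> (1 - t) * (\<integral>x. h x u \<partial>\<pi>) + t * (\<integral>x. h x v \<partial>\<pi>)"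
    using int by simp
qed simp

text \<open>The argument is pathwise outside one null set, so \<open>y\<close> can be an arbitrary
  selection of minimisers. The null set is a countable union, because limits enter at countably many
  points only.\<close>

theorem (in prob_space) convex_sample_average_consistent:
  fixes h :: "'b \<Rightarrow> 'e::euclidean_space \<Rightarrow> real" and \<xi> :: "nat \<Rightarrow> 'a \<Rightarrow> 'b"
  assumes indep: "indep_vars (\<lambda>_. N) \<xi> {1..}"
    and law: "\<And>j. 1 \<le> j \<Longrightarrow> distr M N (\<xi> j) = \<pi>"
    and meas: "\<And>u. (\<lambda>x. h x u) \<in> borel_measurable N"
    and int: "\<And>u. integrable \<pi> (\<lambda>x. h x u)"
    and nonneg: "\<And>x u. 0 \<le> h x u"
    and conv: "AE x in \<pi>. convex_on UNIV (h x)"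
    and min: "\<And>v. v \<noteq> u \<Longrightarrow> (\<integral>x. h x u \<partial>\<pi>) < (\<integral>x. h x v \<partial>\<pi>)"
    and est: "AE \<omega> in M. \<forall>n\<ge>1. \<forall>v. 1 / real n * (\<Sum>j=1..n. h (\<xi> j \<omega>) (y n \<omega>)) \<le> 1 / real n * (\<Sum>j=1..n. h (\<xi> j \<omega>) v)"
  shows "AE \<omega> in M. (\<lambda>n. y n \<omega>) \<longlonglongrightarrow> u"
proof -
  have \<xi>_meas: "\<xi> j \<in> measurable M N" if "1 \<le> j" for j
    using indep that by (auto simp: indep_vars_def)
  obtain D :: "'e set" where D: "countable D" "\<And>U. open U \<Longrightarrow> U \<noteq> {} \<Longrightarrow> \<exists>q\<in>D. q \<in> U"
    by (rule countable_dense_setE) blast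
  obtain K where K: "finite K" "cball u 2 \<subseteq> convex hull K"
    by (rule cball_subset_finite_convex_hull)
  have slln: "AE \<omega> in M. (\<lambda>n. 1 / real n * (\<Sum>j=1..n. h (\<xi> j \<omega>) v)) \<longlonglongrightarrow> (\<integral>x. h x v \<partial>\<pi>)" for v
  proof -
    \<comment> \<open>Samples are numbered from 1, whereas the strong law averages over indices
      below \<open>n\<close>; hence the shift by \<open>Suc\<close>.\<close>
    define X where "X i \<omega> = h (\<xi> (Suc i) \<omega>) v" for i \<omega>
    have distr: "distr M borel (X i) = distr \<pi> borel (\<lambda>x. h x v)" for i
      unfolding law[of "Suc i", symmetric, simplified]
      by (subst distr_distr[OF meas \<xi>_meas]) (auto simp: X_def[abs_def] comp_def)
    have X0: "expectation (X 0) = (\<integral>x. h x v \<partial>\<pi>)" "integrable M (X 0)"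
      using integral_distr[OF \<xi>_meas[of "Suc 0"] meas[of v]]
        integrable_distr_eq[OF \<xi>_meas[of "Suc 0"] meas[of v]] law[of "Suc 0"] int[of v]
      by (auto simp: X_def[abs_def])
    have "AE \<omega> in M. (\<lambda>n. (\<Sum>i<n. X i \<omega>) / real n) \<longlonglongrightarrow> expectation (X 0)"
    proof (rule strong_law_of_large_numbers_nonneg)
      show "random_variable borel (X i)" for i
        using measurable_compose[OF \<xi>_meas[of "Suc i"] meas[of v]] by (simp add: X_def[abs_def])
      show "indep_var borel (X i) borel (X j)" if "i \<noteq> j" for i j
        using that indep_var_compose[OF indep_vars_imp_indep_var[OF indep, of "Suc i" "Suc j"] meas[of v] meas[of v]]
        by (simp add: X_def[abs_def] comp_def)
      show "0 \<le> X i \<omega>" for i \<omega> by (simp add: X_def nonneg)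
    qed (simp_all add: distr X0)
    then show ?thesis
      unfolding X0 by (simp add: X_def sum.atLeast1_atMost_eq)
  qed
  have "AE \<omega> in M. \<forall>q\<in>insert u (D \<union> K). (\<lambda>n. 1 / real n * (\<Sum>j=1..n. h (\<xi> j \<omega>) q)) \<longlonglongrightarrow> (\<integral>x. h x q \<partial>\<pi>)"
    using D(1) K(1) slln by (subst AE_ball_countable) (auto intro: countable_finite)
  \<comment> \<open>A null set of \<open>\<pi>\<close> pulls back to a null set under each of the
    countably many samples.\<close>
  moreover have "AE \<omega> in M. \<forall>j\<in>{1..}. convex_on UNIV (h (\<xi> j \<omega>))"
    using conv law by (subst AE_ball_countable) (auto intro!: AE_distrD[OF \<xi>_meas])
  ultimately show ?thesis
    using est
  proof eventually_elim
    case (elim \<omega>)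
    let ?g = "\<lambda>n v. 1 / real n * (\<Sum>j=1..n. h (\<xi> j \<omega>) v)"
    show ?case
    proof (rule argmin_tendsto_of_convex[where g = ?g and K = K and D = D and f = "\<lambda>v. \<integral>x. h x v \<partial>\<pi>"])
      show "continuous_on UNIV (\<lambda>v. \<integral>x. h x v \<partial>\<pi>)"
        by (intro convex_on_continuous convex_on_expectation int conv) simp
      \<comment> \<open>For \<open>n = 0\<close> the factor \<open>1 / real n\<close> is 0, so the
        average is the zero function and convexity holds for every \<open>n\<close>.\<close>
      have "convex_on UNIV (\<lambda>v. \<Sum>j=1..n. h (\<xi> j \<omega>) v)" for n
        using elim(2) by (induction n) (auto intro!: convex_on_add simp: convex_on_const)
      then show "eventually (\<lambda>n. convex_on UNIV (?g n)) sequentially"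
        by (intro always_eventually allI convex_on_cmul) auto
      show "eventually (\<lambda>n. \<forall>v. ?g n (y n \<omega>) \<le> ?g n v) sequentially"
        using elim(3) unfolding eventually_sequentially by blast
    qed (use D K min elim(1) in auto)
  qed
qed

section \<open>Sets of minimisers and the comparison of the two objectives\<close>

lemma argmin_set_add_const: "argmin_set (\<lambda>u. f u + c) = argmin_set f"
  by (simp add: argmin_set_def is_arg_min_def)

lemma mem_argmin_set_iff: "u \<in> argmin_set f \<longleftrightarrow> (\<forall>v. f u \<le> f v)"
  by (auto simp: argmin_set_def is_arg_min_def not_less)

lemma argmin_set_singleton_less:
  assumes "argmin_set f = {u}" "v \<noteq> u"
  shows "f u < f v"
proof (rule ccontr)
  assume "\<not> f u < f v"
  moreover have "f u \<le> f w" for w using assms(1) mem_argmin_set_iff[of u f] by auto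
  ultimately have "v \<in> argmin_set f" unfolding mem_argmin_set_iff by (meson not_less order_trans)
  with assms show False by simp
qed

theorem theorem1:
  fixes F :: "real ^ 'n \<Rightarrow> real ^ 'k"
    and S :: "real ^ 'k ^ 'k" and G :: "real ^ 'n ^ 'n"
    and d :: "real ^ 'k" and u0 :: "real ^ 'n"
    and P :: "'a measure"
    and \<sigma> \<epsilon> :: "'a \<Rightarrow> real ^ 'k" and \<delta> lam :: "'a \<Rightarrow> real ^ 'n"
    and \<pi> :: "('k, 'n) sample measure"
    and M :: "'w measure" and \<xi> :: "nat \<Rightarrow> 'w \<Rightarrow> ('k, 'n) sample"
  assumes S: "sym_pos_def S" and G: "sym_pos_def G"
    and P: "prob_space P"
    and rv: "\<sigma> \<in> borel_measurable P" "\<epsilon> \<in> borel_measurable P"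
            "\<delta> \<in> borel_measurable P" "lam \<in> borel_measurable P"
    and indep: "indep_vectors4 P \<sigma> \<epsilon> \<delta> lam"
    and second_moments:
      "integrable P (\<lambda>\<omega>. (norm (\<sigma> \<omega>))\<^sup>2)" "integrable P (\<lambda>\<omega>. (norm (\<epsilon> \<omega>))\<^sup>2)"
      "integrable P (\<lambda>\<omega>. (norm (\<delta> \<omega>))\<^sup>2)" "integrable P (\<lambda>\<omega>. (norm (lam \<omega>))\<^sup>2)"
    and mean_\<sigma>: "(\<integral>\<omega>. \<sigma> \<omega> \<partial>P) = 0"
    and cov_\<epsilon>: "(\<integral>\<omega>. outer (\<epsilon> \<omega>) (\<epsilon> \<omega>) \<partial>P) = matrix_inv S"
    and mean_\<delta>: "(\<integral>\<omega>. \<delta> \<omega> \<partial>P) = 0"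
    and cov_lam: "(\<integral>\<omega>. outer (lam \<omega>) (lam \<omega>) \<partial>P) = matrix_inv G"
    and law: "\<pi> = distr P borel (\<lambda>\<omega>. (\<sigma> \<omega>, \<epsilon> \<omega>, \<delta> \<omega>, lam \<omega>))"
    and M: "prob_space M"
    and samples_indep: "prob_space.indep_vars M (\<lambda>_. borel) \<xi> {1..}"
    and samples_law: "\<And>j. j \<ge> 1 \<Longrightarrow> distr M borel (\<xi> j) = \<pi>"
    and J_min: "argmin_set (map_objective F S G u0 d) \<noteq> {}"
    and JN_min: "AE \<omega> in M. \<forall>N\<ge>1. argmin_set (empirical_objective N (\<lambda>j. \<xi> j \<omega>) F u0 d) \<noteq> {}"
    and convex_C2: "AE x in \<pi>. convex_on UNIV (rand_objective F u0 d x) \<and>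
                      twice_cont_differentiable (rand_objective F u0 d x)"
    and meas: "(\<lambda>((u, u0', d'), x). rand_objective F u0' d' x u) \<in> borel_measurable (borel \<Otimes>\<^sub>M \<pi>)"
  shows "argmin_set (map_objective F S G u0 d) = argmin_set (expected_objective \<pi> F u0 d) \<and>
    (\<forall>(uMAP :: real ^ 'n) (uhat :: nat \<Rightarrow> 'w \<Rightarrow> real ^ 'n).
      argmin_set (map_objective F S G u0 d) = {uMAP} \<longrightarrow>
      (AE \<omega> in M. \<forall>N\<ge>1. uhat N \<omega> \<in> argmin_set (empirical_objective N (\<lambda>j. \<xi> j \<omega>) F u0 d)) \<longrightarrow>
      (AE \<omega> in M. (\<lambda>N. uhat N \<omega>) \<longlonglongrightarrow> uMAP))"
proof -
  interpret P: prob_space P by (rule P)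
  interpret M: prob_space M by (rule M)
  let ?h = "rand_objective F u0 d"
  \<comment> \<open>The prior residual is replaced by its negative so that both squares take the
    form \<open>X \<bullet> (a + Y)\<close> with a centred \<open>Y\<close>.\<close>
  have h_eq: "?h x u = 1/2 * (fst (snd x) \<bullet> ((d - F u) + fst x))\<^sup>2
      + 1/2 * (snd (snd (snd x)) \<bullet> ((u0 - u) + fst (snd (snd x))))\<^sup>2" for x u
    by (simp add: rand_objective_def split_beta inner_simps power2_commute algebra_simps)
  have h_meas: "(\<lambda>x. ?h x u) \<in> borel_measurable borel" for u
    unfolding h_eq by (intro borel_measurable_continuous_onI continuous_intros)
  have sample_meas: "(\<lambda>\<omega>. (\<sigma> \<omega>, \<epsilon> \<omega>, \<delta> \<omega>, lam \<omega>)) \<in> measurable P borel"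
    using rv by (intro borel_measurable_Pair)
  have ind: "P.indep_sets (\<lambda>i::nat. [sets (vimage_algebra (space P) \<sigma> borel), sets (vimage_algebra (space P) \<epsilon> borel),
      sets (vimage_algebra (space P) \<delta> borel), sets (vimage_algebra (space P) lam borel)] ! i) {..<4}"
    using indep unfolding indep_vectors4_def .
  \<comment> \<open>The numbers are positions in the list of sigma-algebras. Independence acts
    inside each quadratic form; the two forms are only added and are treated by linearity.\<close>
  have ind1: "P.indep_var borel \<epsilon> borel \<sigma>"
    by (rule P.indep_var_of_indep_sets[OF ind, of 1 0]) (use rv in auto)
  have ind2: "P.indep_var borel lam borel \<delta>"
    by (rule P.indep_var_of_indep_sets[OF ind, of 3 2]) (use rv in auto)
  note noise = P.expectation_inner_shift_square[OF ind1 second_moments(2,1) mean_\<sigma>, unfolded cov_\<epsilon>]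
  note prior = P.expectation_inner_shift_square[OF ind2 second_moments(4,3) mean_\<delta>, unfolded cov_lam]
  define c where "c = 1/2 * P.expectation (\<lambda>\<omega>. (\<epsilon> \<omega> \<bullet> \<sigma> \<omega>)\<^sup>2) + 1/2 * P.expectation (\<lambda>\<omega>. (lam \<omega> \<bullet> \<delta> \<omega>)\<^sup>2)"
  have h_int: "integrable \<pi> (\<lambda>x. ?h x u)" for u
    unfolding law integrable_distr_eq[OF sample_meas h_meas] unfolding h_eq
    using noise(1)[of "d - F u"] prior(1)[of "u0 - u"] by simp
  have weighted_minus: "weighted_norm_sq W (u0 - u) = weighted_norm_sq W (u - u0)" for W u
    using matrix_vector_mult_diff_distrib[of W u0 u] matrix_vector_mult_diff_distrib[of W u u0]
    by (simp add: weighted_norm_sq_def inner_simps)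
  have expected_eq: "expected_objective \<pi> F u0 d = (\<lambda>u. map_objective F S G u0 d u + c)"
  proof
    fix u
    have "expected_objective \<pi> F u0 d u = P.expectation (\<lambda>\<omega>. 1/2 * (\<epsilon> \<omega> \<bullet> ((d - F u) + \<sigma> \<omega>))\<^sup>2
        + 1/2 * (lam \<omega> \<bullet> ((u0 - u) + \<delta> \<omega>))\<^sup>2)"
      unfolding expected_objective_def law integral_distr[OF sample_meas h_meas] unfolding h_eq by simp
    also have "\<dots> = map_objective F S G u0 d u + c"
      using noise[of "d - F u"] prior[of "u0 - u"]
      by (simp add: map_objective_def weighted_minus c_def add_divide_distrib)
    finally show "expected_objective \<pi> F u0 d u = map_objective F S G u0 d u + c" .
  qed
  have same_argmin: "argmin_set (expected_objective \<pi> F u0 d) = argmin_set (map_objective F S G u0 d)"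
    unfolding expected_eq by (rule argmin_set_add_const)
  show ?thesis
  proof (intro conjI allI impI)
    fix uMAP :: "real ^ 'n" and uhat :: "nat \<Rightarrow> 'w \<Rightarrow> real ^ 'n"
    assume unique: "argmin_set (map_objective F S G u0 d) = {uMAP}"
      and est: "AE \<omega> in M. \<forall>N\<ge>1. uhat N \<omega> \<in> argmin_set (empirical_objective N (\<lambda>j. \<xi> j \<omega>) F u0 d)"
    show "AE \<omega> in M. (\<lambda>N. uhat N \<omega>) \<longlonglongrightarrow> uMAP"
    proof (rule M.convex_sample_average_consistent[where h = ?h and \<pi> = \<pi>, OF samples_indep samples_law h_meas h_int])
      show "0 \<le> ?h x u" for x u by (simp add: h_eq)
      show "AE x in \<pi>. convex_on UNIV (?h x)" using convex_C2 by eventually_elim blast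
      \<comment> \<open>Uniqueness of the minimiser becomes strict inequality, after the equality of
        the two sets of minimisers has moved it to the expected objective.\<close>
      show "(\<integral>x. ?h x uMAP \<partial>\<pi>) < (\<integral>x. ?h x v \<partial>\<pi>)" if "v \<noteq> uMAP" for v
        using argmin_set_singleton_less[OF _ that, of "expected_objective \<pi> F u0 d"] unique
        by (simp add: same_argmin expected_objective_def)
      show "AE \<omega> in M. \<forall>n\<ge>1. \<forall>v. 1 / real n * (\<Sum>j=1..n. ?h (\<xi> j \<omega>) (uhat n \<omega>))
          \<le> 1 / real n * (\<Sum>j=1..n. ?h (\<xi> j \<omega>) v)"
        using est unfolding mem_argmin_set_iff empirical_objective_def .
    qed simp_all
  qed (simp add: same_argmin)
qed

end
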